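(* Let $x\in\mathbb{C}\setminus(-\infty,0]$. Then the Ramanujan period function $\mathcal{F}_1$ satisfies: (1) the period relation $$\mathcal{F}_1(x)-\mathcal{F}_1(x+1)-\frac{1}{x+1}\,\mathcal{F}_1\!\left(\frac{x}{x+1}\right)=0;$$ (2) the symmetric relation $$\mathcal{F}_1(x)-\frac1x\,\mathcal{F}_1\!\left(\frac1x\right)=0.$$
   Context: For $x\in\mathbb{C}\setminus(-\infty,0]$, let $$\mathscr{F}_1(x)=\sum_{n=1}^\infty\left\{\psi(nx)+\frac{1}{2nx}-\log(nx)\right\},\qquad \mathcal{F}_1(x)=\mathscr{F}_1(x)-\frac12\left(\gamma-\log\left(\frac{2\pi}{x}\right)\right),$$ where $\psi=\Gamma'/\Gamma$ is the digamma function, $\gamma$ is Euler's constant, and $\log$ is the principal branch. $\mathcal{F}_1$ is called the Ramanujan period function. *)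

theory Defs
  imports "HOL-Complex_Analysis.Complex_Analysis"
begin

text \<open>
  The summation index is shifted: the term for \<open>n = 0\<close> below is the term
  for \<open>n = 1\<close> of the usual series. The terms are \<open>O(1 / n ^ 2)\<close> for every \<open>x\<close> in the
  slit plane \<open>- \<real>\<^sub>\<le>\<^sub>0\<close>, so there the series converges and \<open>suminf\<close> is its actual
  value; off the slit plane the value carries no meaning.
\<close>

definition ramanujan_digamma_series :: "complex \<Rightarrow> complex" where
  "ramanujan_digamma_series x =
     (\<Sum>n. Digamma (of_nat (Suc n) * x) + 1 / (2 * of_nat (Suc n) * x) - Ln (of_nat (Suc n) * x))"

definition ramanujan_period_function :: "complex \<Rightarrow> complex" where
  "ramanujan_period_function x =
     ramanujan_digamma_series x - 1 / 2 * (euler_mascheroni - Ln (2 * of_real pi / x))"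

end

theory Submission
  imports Defs
begin

text \<open>
  Up to sign, the period function at \<open>x\<close> is the regularised sum of \<open>1 / (n x + k)\<close> over the
  points of the cone \<open>n, k \<ge> 0\<close> other than the origin, where points on the two boundary rays count
  with weight one half. Seen in this way both relations are facts about cones. Exchanging the two
  generators \<open>x\<close> and \<open>1\<close> of the cone gives the symmetric relation, because
  \<open>n x + k = x (k (1 / x) + n)\<close>. Cutting the cone along the ray through \<open>x + 1\<close> gives the period
  relation: the half with generators \<open>x + 1, 1\<close> contributes \<open>n (x + 1) + k\<close>, the half with generators
  \<open>x, x + 1\<close> contributes \<open>n x + k (x + 1)\<close>, which is \<open>x + 1\<close> times \<open>n (x / (x + 1)) + k\<close>, and the
  common ray is split evenly between the halves.

  The sum over the cone diverges, so it is truncated, to the triangle \<open>n + k \<le> N\<close> or to the square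
  \<open>n, k \<le> N\<close>, with weight one half on every edge and weight zero at every corner. For such truncations
  the manipulations above are exact finite identities: \<open>triangle_sum_swap\<close> reflects a triangle, and
  \<open>square_sum_eq_triangle_sums\<close> cuts a square along its diagonal into two triangles.

  It remains to see that the truncated sums equal \<open>N B - F(x) + o(1)\<close>, where \<open>F\<close> is the period
  function and \<open>B\<close> does not depend on \<open>N\<close> (\<open>triangle_sum_asymptotics\<close>, \<open>square_sum_asymptotics\<close>).
  An exact relation between truncated sums then yields the same relation between their constant terms,
  whatever the coefficients \<open>B\<close> are (\<open>constant_term_unique\<close>). The asymptotics come from comparing a
  sum along a row with the integral of \<open>1 / z\<close> by the trapezoid rule. The error \<open>g(z)\<close> on one step of
  length one satisfies \<open>\<Sum>k. g (z + k) = \<psi>(z) + 1 / (2 z) - log z\<close>, and it is cubically small, so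
  that the errors \<open>g (n x + k)\<close> over the whole cone form an absolutely convergent double series with
  sum the digamma series of the theorem. The logarithms produced by the integrals are summed by the
  trapezoid rule again, the factorials among them by Stirling's formula, whose constant is where
  \<open>log (2 \<pi>)\<close> comes from; Euler's constant comes from the boundary ray \<open>n = 0\<close>, which contributes half a
  harmonic number. The remaining terms \<open>log N\<close> cancel.

  Everything takes place for complex \<open>x\<close> in the slit plane. The only geometric input is that the
  closed cone spanned by \<open>1\<close> and \<open>x\<close> meets \<open>\<real>\<^sub>\<le>\<^sub>0\<close> at the origin only, and that \<open>\<bar>a x + b\<bar>\<close> is at least
  a constant times \<open>a + b\<close> on it.
\<close>

section \<open>The trapezoid rule on a segment\<close>

text \<open>
  The error is \<open>h(b) - h(a)\<close> for \<open>h(z) = F(z) - (z - a) (f(a) + f(z)) / 2\<close>. The derivative of \<open>h\<close> is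
  half of the first-order Taylor remainder \<open>f(z) - f(a) - (z - a) f'(z)\<close>, hence quadratically small,
  and integrating it over the segment gains the third power.
  The lemma is applied to \<open>f(z) = 1 / z\<close> and to \<open>f = log\<close>.
\<close>

lemma trapezoid_rule_error_bound:
  fixes F f f' f'' :: "'a::real_normed_field \<Rightarrow> 'a"
  assumes F: "\<And>z. z \<in> closed_segment a b \<Longrightarrow> (F has_field_derivative f z) (at z)"
    and f: "\<And>z. z \<in> closed_segment a b \<Longrightarrow> (f has_field_derivative f' z) (at z)"
    and f': "\<And>z. z \<in> closed_segment a b \<Longrightarrow> (f' has_field_derivative f'' z) (at z)"
    and M: "\<And>z. z \<in> closed_segment a b \<Longrightarrow> norm (f'' z) \<le> M"
  shows "norm (F b - F a - (b - a) * (f a + f b) / 2) \<le> M * norm (b - a) ^ 3 / 2"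
proof -
  let ?S = "closed_segment a b"
  have M0: "M \<ge> 0"
    by (rule order_trans[OF norm_ge_zero M[of a]]) simp
  have dist: "norm (z - a) \<le> norm (b - a)" if "z \<in> ?S" for z
    using that by (rule segment_bound(1))
  have taylor: "norm (f z - f a - (z - a) * f' z) \<le> M * norm (b - a) ^ 2" if z: "z \<in> ?S" for z
  proof -
    have sub: "closed_segment a z \<subseteq> ?S"
      using z by (simp add: subset_closed_segment)
    have f'_diff: "norm (f' u - f' z) \<le> M * norm (b - a)" if "u \<in> closed_segment a z" for u
    proof -
      have "norm (f' u - f' z) \<le> M * norm (u - z)"
        using sub that z
        by (intro field_differentiable_bound[where S = ?S and f' = f''])
           (auto intro: has_field_derivative_at_within f' M)
      also have "norm (u - z) \<le> norm (b - a)"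
        using that dist[OF z] segment_bound(2)[OF that] by (simp add: norm_minus_commute)
      finally show ?thesis
        using M0 by (simp add: mult_left_mono)
    qed
    have "norm ((f z - z * f' z) - (f a - a * f' z)) \<le> (M * norm (b - a)) * norm (z - a)"
    proof (rule field_differentiable_bound[where S = "closed_segment a z"
            and f = "\<lambda>u. f u - u * f' z" and f' = "\<lambda>u. f' u - f' z"])
      fix u assume u: "u \<in> closed_segment a z"
      show "((\<lambda>u. f u - u * f' z) has_field_derivative f' u - f' z)
              (at u within closed_segment a z)"
        using u sub by (auto intro!: derivative_eq_intros has_field_derivative_at_within[OF f])
    qed (use f'_diff in auto)
    also have "\<dots> \<le> (M * norm (b - a)) * norm (b - a)"
      using M0 dist[OF z] by (intro mult_left_mono) auto
    finally show ?thesis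
      by (simp add: algebra_simps power2_eq_square)
  qed
  define h where "h = (\<lambda>z. F z - (z - a) * (f a + f z) / 2)"
  have "norm (h b - h a) \<le> (M * norm (b - a) ^ 2 / 2) * norm (b - a)"
  proof (rule field_differentiable_bound[where S = ?S
          and f' = "\<lambda>z. (f z - f a - (z - a) * f' z) / 2"])
    fix z assume z: "z \<in> ?S"
    have "(h has_field_derivative f z - ((f a + f z) + (z - a) * f' z) / 2) (at z)"
      unfolding h_def using F[OF z] f[OF z]
      by (auto intro!: derivative_eq_intros)
    moreover have "f z - ((f a + f z) + (z - a) * f' z) / 2 = (f z - f a - (z - a) * f' z) / 2"
      by (simp add: field_simps)
    ultimately show "(h has_field_derivative (f z - f a - (z - a) * f' z) / 2) (at z within ?S)"
      by (simp add: has_field_derivative_at_within)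
    show "norm ((f z - f a - (z - a) * f' z) / 2) \<le> M * norm (b - a) ^ 2 / 2"
      using taylor[OF z] by (simp add: norm_divide)
  qed auto
  thus ?thesis
    by (simp add: h_def power2_eq_square power3_eq_cube algebra_simps)
qed

section \<open>Half-weighted sums over triangles and squares\<close>

definition discrete_trapezoid :: "(nat \<Rightarrow> complex) \<Rightarrow> nat \<Rightarrow> complex" where
  "discrete_trapezoid f m = (\<Sum>k<m. (f k + f (Suc k)) / 2)"

lemma discrete_trapezoid_Suc:
  "discrete_trapezoid f (Suc m) = discrete_trapezoid f m + (f m + f (Suc m)) / 2"
  by (simp add: discrete_trapezoid_def)

lemma discrete_trapezoid_eq_lessThan:
  "discrete_trapezoid f m = (\<Sum>k<m. f k) - f 0 / 2 + f m / 2"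
proof (induction m)
  case 0
  show ?case by (simp add: discrete_trapezoid_def)
next
  case (Suc m)
  show ?case by (simp add: discrete_trapezoid_Suc Suc.IH) (simp add: field_simps)
qed

lemma discrete_trapezoid_split:
  "discrete_trapezoid f (m + n) = discrete_trapezoid f m + discrete_trapezoid (\<lambda>k. f (m + k)) n"
  by (induction n) (simp_all add: discrete_trapezoid_def)

lemma discrete_trapezoid_eq_interior:
  assumes "m > 0"
  shows "discrete_trapezoid f m = (f 0 + f m) / 2 + (\<Sum>k=1..<m. f k)"
  using assms
proof (induction m rule: nat_induct_non_zero)
  case 1
  show ?case by (simp add: discrete_trapezoid_def)
next
  case (Suc m)
  thus ?case by (simp add: discrete_trapezoid_Suc field_simps)
qed

text \<open>
  The function \<open>f\<close> is summed over the triangle \<open>n, k \<ge> 0\<close>, \<open>n + k \<le> N\<close>: interior points have weight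
  one, points on the edges weight one half and the three corners weight zero. Arranging the points in
  rows, as is done here, gives the half weights for \<open>k = 0\<close> and \<open>n + k = N\<close> by means of
  \<open>discrete_trapezoid\<close>. In the application \<open>f 0 0\<close> is the meaningless \<open>1 / 0\<close>; it lies at a
  corner and so carries no weight.
\<close>

definition triangle_sum :: "(nat \<Rightarrow> nat \<Rightarrow> complex) \<Rightarrow> nat \<Rightarrow> complex" where
  "triangle_sum f N =
     (\<Sum>n=1..<N. discrete_trapezoid (f n) (N - n)) + (\<Sum>k=1..<N. f 0 k) / 2"

text \<open>
  The same convention for the square \<open>n, k \<le> N\<close>: half weight on the edges, none at the corners.
\<close>

definition square_sum :: "(nat \<Rightarrow> nat \<Rightarrow> complex) \<Rightarrow> nat \<Rightarrow> complex" where
  "square_sum f N =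
     (\<Sum>n=1..<N. discrete_trapezoid (f n) N) + (\<Sum>k=1..<N. f 0 k + f N k) / 2"

text \<open>
  Passing from \<open>N\<close> to \<open>N + 1\<close> raises the old hypotenuse from weight one half to weight one, adds the
  new hypotenuse with weight one half, and turns the corners \<open>(N, 0)\<close> and \<open>(0, N)\<close> into edge points.
  This increment treats both coordinates alike, which is not visible from the arrangement in rows, and
  it makes the combinatorial identities below provable by induction on \<open>N\<close>.
\<close>

lemma triangle_sum_Suc:
  assumes "N > 0"
  shows "triangle_sum f (Suc N) = triangle_sum f N +
           ((\<Sum>n=1..<N. f n (N - n)) + (\<Sum>n=1..<Suc N. f n (Suc N - n)) + f N 0 + f 0 N) / 2"
proof -
  have "(\<Sum>n=1..<N. discrete_trapezoid (f n) (Suc N - n)) =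
        (\<Sum>n=1..<N. discrete_trapezoid (f n) (N - n) + (f n (N - n) + f n (Suc N - n)) / 2)"
    by (intro sum.cong refl) (simp add: Suc_diff_le discrete_trapezoid_Suc)
  thus ?thesis
    using assms
    by (simp add: triangle_sum_def discrete_trapezoid_Suc discrete_trapezoid_def[of _ 0]
        sum.distrib sum_divide_distrib[symmetric] sum_distrib_left field_simps)
qed

lemma triangle_sum_01: "N \<le> 1 \<Longrightarrow> triangle_sum f N = 0"
  by (auto simp: triangle_sum_def)

lemma sum_antidiagonal_swap:
  fixes f :: "nat \<Rightarrow> nat \<Rightarrow> 'a::comm_monoid_add"
  shows "(\<Sum>n=1..<N. f n (N - n)) = (\<Sum>n=1..<N. f (N - n) n)"
  by (rule sum.reindex_bij_witness[of _ "\<lambda>n. N - n" "\<lambda>n. N - n"]) auto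

lemma triangle_sum_swap: "triangle_sum f N = triangle_sum (\<lambda>n k. f k n) N"
proof (induction N)
  case 0
  show ?case by (simp add: triangle_sum_01)
next
  case (Suc N)
  show ?case
  proof (cases "N = 0")
    case False
    thus ?thesis
      using Suc sum_antidiagonal_swap[of f N] sum_antidiagonal_swap[of f "Suc N"]
      by (simp add: triangle_sum_Suc)
  qed (simp add: triangle_sum_01)
qed

text \<open>
  The shear \<open>(n, k) \<mapsto> (n + k, k)\<close> carries the standard triangle onto the part of the square below the
  diagonal, turning hypotenuses into columns.
\<close>

lemma lower_triangle_sum:
  assumes "N > 0"
  shows "triangle_sum (\<lambda>n k. f (n + k) k) N =
           (\<Sum>n=1..<N. discrete_trapezoid (f n) n) + (\<Sum>k=1..<N. f N k) / 2"
  using assms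
proof (induction N rule: nat_induct_non_zero)
  case 1
  show ?case by (simp add: triangle_sum_01)
next
  case (Suc N)
  have "(\<Sum>n=1..<M. f (n + (M - n)) (M - n)) = (\<Sum>k=1..<M. f M k)" for M
    by (subst sum_antidiagonal_swap) (auto intro: sum.cong)
  moreover have "(\<Sum>n=1..<Suc N. discrete_trapezoid (f n) n) =
      (\<Sum>n=1..<N. discrete_trapezoid (f n) n) + discrete_trapezoid (f N) N"
    using Suc.hyps by simp
  ultimately show ?case
    using Suc
    by (simp add: triangle_sum_Suc discrete_trapezoid_eq_interior[of N] field_simps
        del: sum.op_ivl_Suc)
qed

text \<open>
  Each point of the diagonal lies on an edge of both triangles and so collects its full weight.
\<close>

lemma square_sum_eq_triangle_sums:
  assumes "N > 0"
  shows "square_sum f N =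
           triangle_sum (\<lambda>n k. f n (n + k)) N + triangle_sum (\<lambda>n k. f (n + k) k) N"
proof -
  have "discrete_trapezoid (f n) N =
          discrete_trapezoid (f n) n + discrete_trapezoid (\<lambda>k. f n (n + k)) (N - n)"
    if "n < N" for n
    using discrete_trapezoid_split[of "f n" n "N - n"] that by simp
  hence "(\<Sum>n=1..<N. discrete_trapezoid (f n) N) = (\<Sum>n=1..<N. discrete_trapezoid (f n) n) +
          (\<Sum>n=1..<N. discrete_trapezoid (\<lambda>k. f n (n + k)) (N - n))"
    by (simp add: sum.distrib[symmetric])
  thus ?thesis
    by (simp add: lower_triangle_sum[OF assms] square_sum_def sum.distrib
        triangle_sum_def[of "\<lambda>n k. f n (n + k)"] field_simps)
qed

section \<open>The cone spanned by 1 and a point of the slit plane\<close>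

lemma cone_avoids_nonpos_Reals:
  fixes a b :: real and x :: complex
  assumes x: "x \<notin> \<real>\<^sub>\<le>\<^sub>0" and "a \<ge> 0" "b \<ge> 0" "a + b > 0"
  shows "of_real a * x + of_real b \<notin> \<real>\<^sub>\<le>\<^sub>0"
proof
  assume *: "of_real a * x + of_real b \<in> \<real>\<^sub>\<le>\<^sub>0"
  show False
  proof (cases "a = 0")
    case True
    thus False using * assms by (simp add: complex_nonpos_Reals_iff)
  next
    case False
    hence "Im x = 0" using * by (simp add: complex_nonpos_Reals_iff)
    hence "Re x > 0" using x by (auto simp: complex_nonpos_Reals_iff)
    hence "a * Re x > 0" using False assms by simp
    thus False using * assms by (simp add: complex_nonpos_Reals_iff)
  qed
qed

lemma lattice_point_avoids_nonpos_Reals: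
  fixes x :: complex
  assumes "x \<notin> \<real>\<^sub>\<le>\<^sub>0" "n > 0"
  shows "of_nat n * x + of_nat k \<notin> \<real>\<^sub>\<le>\<^sub>0"
  using cone_avoids_nonpos_Reals[OF assms(1), of "real n" "real k"] assms(2) by simp

text \<open>
  By homogeneity it is enough to consider \<open>a + b = 1\<close>, that is, the segment from \<open>1\<close> to \<open>x\<close>. This
  segment is compact and avoids the origin.
\<close>

lemma cone_norm_lower_bound:
  fixes x :: complex
  assumes x: "x \<notin> \<real>\<^sub>\<le>\<^sub>0"
  obtains c where "c > 0"
    "\<And>a b. a \<ge> 0 \<Longrightarrow> b \<ge> 0 \<Longrightarrow> c * (a + b) \<le> norm (of_real a * x + of_real b)"
proof -
  define h where "h = (\<lambda>t::real. norm (of_real t * x + of_real (1 - t)))"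
  have "continuous_on {0..1} h"
    unfolding h_def by (intro continuous_intros)
  then obtain t where t: "t \<in> {0..1}" "\<And>s. s \<in> {0..1} \<Longrightarrow> h t \<le> h s"
    using continuous_attains_inf[of "{0..1::real}" h] by auto
  have "of_real t * x + of_real (1 - t) \<notin> \<real>\<^sub>\<le>\<^sub>0"
    using t(1) by (intro cone_avoids_nonpos_Reals[OF x]) auto
  hence "h t > 0"
    by (auto simp: h_def)
  moreover have "h t * (a + b) \<le> norm (of_real a * x + of_real b)" if "a \<ge> 0" "b \<ge> 0" for a b
  proof (cases "a + b = 0")
    case False
    hence ab: "a + b > 0" using that by simp
    have "h t \<le> h (a / (a + b))"
      using that ab by (intro t(2)) (auto simp: field_simps)
    also have "1 - a / (a + b) = b / (a + b)"
      using ab by (simp add: field_simps)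
    hence "h (a / (a + b)) = norm ((of_real a * x + of_real b) / of_real (a + b))"
      by (simp only: h_def) (simp add: add_divide_distrib)
    also have "\<dots> = norm (of_real a * x + of_real b) / (a + b)"
      using ab by (subst norm_divide, subst norm_of_real) simp
    finally show ?thesis
      using ab by (simp add: field_simps)
  qed (use that in auto)
  ultimately show ?thesis
    by (rule that)
qed

section \<open>The digamma series as a double series of trapezoid errors\<close>

text \<open>
  This is the error of the trapezoid rule with one step for the integral of \<open>1 / w\<close> from \<open>z\<close> to
  \<open>z + 1\<close>.
\<close>

definition log_trapezoid_error :: "complex \<Rightarrow> complex" where
  "log_trapezoid_error z = Ln (z + 1) - Ln z - (1 / z + 1 / (z + 1)) / 2"

text \<open>
  The second derivative of \<open>1 / w\<close> is \<open>2 / w\<^sup>3\<close>, and on the segment from \<open>n x + k\<close> to \<open>n x + k + 1\<close>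
  the lower bound for the cone applies. The cubic decay, uniform in both indices, is what makes the
  double series over \<open>n\<close> and \<open>k\<close> converge.
\<close>

lemma log_trapezoid_error_bound:
  assumes x: "x \<notin> \<real>\<^sub>\<le>\<^sub>0"
  obtains C where "C \<ge> 0"
    "\<And>n k. n > 0 \<Longrightarrow>
        norm (log_trapezoid_error (of_nat n * x + of_nat k)) \<le> C / real (n + k) ^ 3"
proof -
  obtain c where c: "c > 0"
    "\<And>a b. a \<ge> 0 \<Longrightarrow> b \<ge> 0 \<Longrightarrow> c * (a + b) \<le> norm (of_real a * x + of_real b)"
    using cone_norm_lower_bound[OF x] by blast
  have "norm (log_trapezoid_error (of_nat n * x + of_nat k)) \<le> (1 / c ^ 3) / real (n + k) ^ 3"
    if n: "n > 0" for n k :: nat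
  proof -
    let ?z = "of_nat n * x + of_nat k :: complex"
    have pt: "\<exists>t\<ge>0. w = of_real (real n) * x + of_real (real k + t)"
      if w: "w \<in> closed_segment ?z (?z + 1)" for w
    proof -
      obtain t where "0 \<le> t" "w = (1 - t) *\<^sub>R ?z + t *\<^sub>R (?z + 1)"
        using w by (auto simp: closed_segment_def)
      thus ?thesis
        by (intro exI[of _ t]) (simp add: scaleR_conv_of_real algebra_simps)
    qed
    have slit: "w \<notin> \<real>\<^sub>\<le>\<^sub>0" if w: "w \<in> closed_segment ?z (?z + 1)" for w
    proof -
      obtain t where t: "t \<ge> 0" "w = of_real (real n) * x + of_real (real k + t)"
        using pt[OF w] by blast
      show ?thesis
        unfolding t(2) using t(1) n by (intro cone_avoids_nonpos_Reals[OF x]) auto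
    qed
    have big: "c * real (n + k) \<le> norm w" if w: "w \<in> closed_segment ?z (?z + 1)" for w
    proof -
      obtain t where t: "t \<ge> 0" "w = of_real (real n) * x + of_real (real k + t)"
        using pt[OF w] by blast
      have "c * real (n + k) \<le> c * (real n + (real k + t))"
        using c(1) t(1) by simp
      also have "\<dots> \<le> norm w"
        unfolding t(2) using t(1) by (intro c(2)) auto
      finally show ?thesis .
    qed
    have pos: "c * real (n + k) > 0"
      using c(1) n by simp
    have "norm (Ln (?z + 1) - Ln ?z - (?z + 1 - ?z) * (1 / ?z + 1 / (?z + 1)) / 2)
            \<le> (2 / (c * real (n + k)) ^ 3) * norm (?z + 1 - ?z) ^ 3 / 2"
    proof (rule trapezoid_rule_error_bound[where f' = "\<lambda>w. - 1 / w ^ 2"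
            and f'' = "\<lambda>w. 2 / w ^ 3"])
      fix w assume w: "w \<in> closed_segment ?z (?z + 1)"
      have w0: "w \<noteq> 0" using slit[OF w] by auto
      show "(Ln has_field_derivative 1 / w) (at w)"
        using has_field_derivative_Ln[OF slit[OF w]] by (simp add: inverse_eq_divide)
      show "((\<lambda>w. 1 / w) has_field_derivative - 1 / w ^ 2) (at w)"
        using w0 by (auto intro!: derivative_eq_intros simp: power2_eq_square)
      show "((\<lambda>w. - 1 / w ^ 2) has_field_derivative 2 / w ^ 3) (at w)"
        using w0 by (auto intro!: derivative_eq_intros simp: field_simps eval_nat_numeral)
      show "norm (2 / w ^ 3) \<le> 2 / (c * real (n + k)) ^ 3"
        using big[OF w] pos w0
        by (auto simp: norm_divide norm_power simp del: of_nat_add intro!: divide_left_mono power_mono mult_pos_pos)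
    qed
    thus ?thesis
      by (simp add: log_trapezoid_error_def power_mult_distrib)
  qed
  moreover have "1 / c ^ 3 \<ge> 0" using c(1) by simp
  ultimately show ?thesis using that by blast
qed

lemma sum_inverse_cubes_le:
  assumes "m > 0"
  shows "(\<Sum>k<K. 1 / real (m + k) ^ 3) \<le> 2 / real m ^ 2"
proof -
  \<comment> \<open>The telescoping majorant \<open>2 / j\<^sup>2 - 2 / (j + 1)\<^sup>2\<close> dominates \<open>1 / j\<^sup>3\<close> for \<open>j \<ge> 1\<close>.\<close>
  have "(\<Sum>k<K. 1 / real (m + k) ^ 3) \<le> 2 / real m ^ 2 - 2 / real (m + K) ^ 2"
  proof (induction K)
    case (Suc K)
    define j where "j = real (m + K)"
    have j: "j \<ge> 1" using assms by (simp add: j_def)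
    have "1 \<le> j * j" using mult_mono[OF j j] j by simp
    hence "1 / j ^ 3 \<le> 2 / j ^ 2 - 2 / (j + 1) ^ 2"
      using j by (simp add: divide_simps) (simp add: power2_eq_square power3_eq_cube algebra_simps)
    thus ?case using Suc by (simp add: j_def algebra_simps)
  qed simp
  also have "\<dots> \<le> 2 / real m ^ 2" by simp
  finally show ?thesis .
qed

lemma sum_log_trapezoid_error:
  "(\<Sum>k<m. log_trapezoid_error (z + of_nat k)) =
     Ln (z + of_nat m) - Ln z - discrete_trapezoid (\<lambda>k. 1 / (z + of_nat k)) m"
  by (induction m) (simp_all add: discrete_trapezoid_def log_trapezoid_error_def algebra_simps)

lemma Ln_add_of_nat_minus_ln_tendsto_0:
  assumes "z \<notin> \<real>\<^sub>\<le>\<^sub>0"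
  shows "(\<lambda>m. Ln (z + of_nat m) - of_real (ln (real m))) \<longlonglongrightarrow> 0"
proof (rule Lim_transform_eventually)
  have "(\<lambda>m. Ln (1 + z / of_nat m)) \<longlonglongrightarrow> Ln (1 + 0)"
    by (intro tendsto_intros lim_const_over_n) auto
  thus "(\<lambda>m. Ln (1 + z / of_nat m)) \<longlonglongrightarrow> 0" by simp
  show "\<forall>\<^sub>F m in sequentially. Ln (1 + z / of_nat m) = Ln (z + of_nat m) - of_real (ln (real m))"
    using eventually_gt_at_top[of 0]
  proof eventually_elim
    case (elim m)
    have "z + of_nat m \<noteq> 0"
      using lattice_point_avoids_nonpos_Reals[OF assms, of 1 m] by auto
    hence "1 + z / of_nat m \<noteq> 0"
      using elim by (simp add: field_simps)
    moreover have "z + of_nat m = of_nat m * (1 + z / of_nat m)"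
      using elim by (simp add: field_simps)
    ultimately show ?case
      using Ln_times_of_nat[of m "1 + z / of_nat m"] elim by simp
  qed
qed

text \<open>
  In a partial sum the logarithms telescope to \<open>log (z + m) - log z\<close> and the reciprocals combine to a
  partial sum of the limit formula for \<open>\<psi>\<close>, the end points giving the correction \<open>1 / (2 z)\<close>.
\<close>

lemma log_trapezoid_error_sums:
  assumes z: "z \<notin> \<real>\<^sub>\<le>\<^sub>0"
  shows "(\<lambda>k. log_trapezoid_error (z + of_nat k)) sums (Digamma z + 1 / (2 * z) - Ln z)"
  unfolding sums_def
proof (rule Lim_transform_eventually)
  have z0: "z \<noteq> 0" using z by auto
  have lim: "(\<lambda>m. 1 / (z + of_nat m)) \<longlonglongrightarrow> 0"
    by (rule tendsto_divide_0[OF tendsto_const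
          tendsto_add_filterlim_at_infinity[OF tendsto_const tendsto_of_nat]])
  note lims = tendsto_add[OF Ln_add_of_nat_minus_ln_tendsto_0[OF z] Digamma_LIMSEQ[OF z0]]
  from tendsto_diff[OF tendsto_diff[OF tendsto_add[OF lims tendsto_const[of "1 / (2 * z)"]]
         tendsto_const[of "Ln z"]] tendsto_divide[OF lim tendsto_const[of 2]]]
  show "(\<lambda>m. (Ln (z + of_nat m) - of_real (ln (real m)) +
          (of_real (ln (real m)) - (\<Sum>k<m. inverse (z + of_nat k)))) +
          1 / (2 * z) - Ln z - 1 / (z + of_nat m) / 2) \<longlonglongrightarrow> Digamma z + 1 / (2 * z) - Ln z"
    by simp
  show "\<forall>\<^sub>F m in sequentially. (Ln (z + of_nat m) - of_real (ln (real m)) +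
          (of_real (ln (real m)) - (\<Sum>k<m. inverse (z + of_nat k)))) +
          1 / (2 * z) - Ln z - 1 / (z + of_nat m) / 2 =
          (\<Sum>k<m. log_trapezoid_error (z + of_nat k))"
    by (intro always_eventually allI) (simp add: sum_log_trapezoid_error
        discrete_trapezoid_eq_lessThan inverse_eq_divide)
qed

lemma sum_log_trapezoid_error_tail:
  assumes C: "\<And>n k. n > 0 \<Longrightarrow>
        norm (log_trapezoid_error (of_nat n * x + of_nat k)) \<le> C / real (n + k) ^ 3"
    and "C \<ge> 0" "n > 0"
  shows "norm (\<Sum>k<K. log_trapezoid_error (of_nat n * x + of_nat (m + k))) \<le>
           2 * C / real (n + m) ^ 2"
proof -
  have "norm (\<Sum>k<K. log_trapezoid_error (of_nat n * x + of_nat (m + k))) \<le>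
          (\<Sum>k<K. C * (1 / real ((n + m) + k) ^ 3))"
  proof (rule sum_norm_le)
    fix k
    show "norm (log_trapezoid_error (of_nat n * x + of_nat (m + k))) \<le>
            C * (1 / real ((n + m) + k) ^ 3)"
      using C[OF \<open>n > 0\<close>, of "m + k"] by (simp only: add.assoc mult_1_right times_divide_eq_right)
  qed
  also have "\<dots> = C * (\<Sum>k<K. 1 / real ((n + m) + k) ^ 3)"
    by (simp add: sum_distrib_left)
  also have "\<dots> \<le> C * (2 / real (n + m) ^ 2)"
    using assms by (intro mult_left_mono sum_inverse_cubes_le) auto
  finally show ?thesis by (simp add: mult_ac)
qed

lemma summable_inverse_squares_Suc: "summable (\<lambda>n. 1 / real (Suc n) ^ 2)"
  using inverse_power_summable[of 2, where 'a = real]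
  by (subst summable_Suc_iff) (simp add: inverse_eq_divide)

text \<open>
  Row \<open>n\<close> of the double series sums to the \<open>n\<close>-th term of the digamma series, and the part of it from
  index \<open>m\<close> on is \<open>O(1 / (n + m)\<^sup>2)\<close>. If all points with \<open>n + k < N\<close> are included, each of
  the fewer than \<open>N\<close> rows is thus wrong by \<open>O(1 / N\<^sup>2)\<close>, so the total error tends to zero. The
  statement therefore covers every truncation that contains the triangle, in particular the square.
\<close>

lemma ramanujan_digamma_series_eq_double_sum:
  fixes x :: complex and m :: "nat \<Rightarrow> nat \<Rightarrow> nat"
  assumes x: "x \<notin> \<real>\<^sub>\<le>\<^sub>0"
    and m: "\<And>N n. 0 < n \<Longrightarrow> n < N \<Longrightarrow> N \<le> n + m N n"
  shows "(\<lambda>N. \<Sum>n=1..<N. \<Sum>k<m N n. log_trapezoid_error (of_nat n * x + of_nat k))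
           \<longlonglongrightarrow> ramanujan_digamma_series x"
proof -
  obtain C where C: "C \<ge> 0" "\<And>n k. n > 0 \<Longrightarrow>
      norm (log_trapezoid_error (of_nat n * x + of_nat k)) \<le> C / real (n + k) ^ 3"
    using log_trapezoid_error_bound[OF x] by blast
  define row where "row = (\<lambda>n m. \<Sum>k<m. log_trapezoid_error (of_nat n * x + of_nat k))"
  define \<phi> where
    "\<phi> = (\<lambda>n. Digamma (of_nat n * x) + 1 / (2 * of_nat n * x) - Ln (of_nat n * x))"
  have tail: "norm (\<phi> n - row n m) \<le> 2 * C / real (n + m) ^ 2" if n: "n > 0" for n m
  proof -
    have "of_nat n * x \<notin> \<real>\<^sub>\<le>\<^sub>0"
      using lattice_point_avoids_nonpos_Reals[OF x n, of 0] by simp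
    from log_trapezoid_error_sums[OF this]
    have "(\<lambda>k. log_trapezoid_error (of_nat n * x + of_nat k)) sums \<phi> n"
      by (simp add: \<phi>_def mult.assoc)
    from sums_split_initial_segment[OF this, of m]
    have "(\<lambda>K. norm (\<Sum>k<K. log_trapezoid_error (of_nat n * x + of_nat (m + k))))
            \<longlonglongrightarrow> norm (\<phi> n - row n m)"
      by (intro tendsto_norm) (simp add: sums_def row_def add.commute)
    thus ?thesis
      using sum_log_trapezoid_error_tail[where C = C and x = x, OF C(2) C(1) n]
      by (intro LIMSEQ_le_const2) auto
  qed
  have "norm (\<phi> (Suc n)) \<le> 2 * C * (1 / real (Suc n) ^ 2)" for n
    using tail[of "Suc n" 0] by (simp add: row_def)
  hence "summable (\<lambda>n. \<phi> (Suc n))"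
    by (intro summable_comparison_test[OF _ summable_mult[OF summable_inverse_squares_Suc]]) auto
  hence "(\<lambda>N. \<Sum>n<N. \<phi> (Suc n)) \<longlonglongrightarrow> ramanujan_digamma_series x"
    by (simp add: ramanujan_digamma_series_def \<phi>_def summable_LIMSEQ)
  hence "(\<lambda>N. \<Sum>n=1..<Suc N. \<phi> n) \<longlonglongrightarrow> ramanujan_digamma_series x"
    by (simp add: sum.atLeast_Suc_lessThan_Suc_shift lessThan_atLeast0 comp_def
        del: sum.op_ivl_Suc)
  hence \<phi>_lim: "(\<lambda>N. \<Sum>n=1..<N. \<phi> n) \<longlonglongrightarrow> ramanujan_digamma_series x"
    by (subst (asm) filterlim_sequentially_Suc)
  have "(\<lambda>N. \<Sum>n=1..<N. row n (m N n) - \<phi> n) \<longlonglongrightarrow> 0"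
  proof (rule Lim_null_comparison)
    show "(\<lambda>N. 2 * C / real N) \<longlonglongrightarrow> 0"
      by (rule lim_const_over_n)
    have "norm (\<Sum>n=1..<N. row n (m N n) - \<phi> n) \<le> 2 * C / real N" if "N > 0" for N
    proof -
      have "norm (\<Sum>n=1..<N. row n (m N n) - \<phi> n) \<le> (\<Sum>n=1..<N. 2 * C / real N ^ 2)"
      proof (rule sum_norm_le)
        fix n assume n: "n \<in> {1..<N}"
        have "norm (row n (m N n) - \<phi> n) \<le> 2 * C / real (n + m N n) ^ 2"
          using tail[of n "m N n"] n by (simp add: norm_minus_commute)
        also have "\<dots> \<le> 2 * C / real N ^ 2"
          using m[of n N] n C(1) by (intro divide_left_mono power_mono mult_pos_pos) auto
        finally show "norm (row n (m N n) - \<phi> n) \<le> 2 * C / real N ^ 2" .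
      qed
      also have "\<dots> = real (N - 1) * (2 * C / real N ^ 2)" by simp
      also have "\<dots> \<le> real N * (2 * C / real N ^ 2)"
        using C(1) by (intro mult_right_mono) auto
      finally show ?thesis using that by (simp add: power2_eq_square)
    qed
    thus "\<forall>\<^sub>F N in sequentially. norm (\<Sum>n=1..<N. row n (m N n) - \<phi> n) \<le> 2 * C / real N"
      by (rule eventually_mono[OF eventually_gt_at_top[of 0]])
  qed
  from tendsto_add[OF this \<phi>_lim] show ?thesis
    by (simp add: sum_subtractf row_def)
qed

section \<open>Stirling's formula\<close>

definition stirling_remainder :: "nat \<Rightarrow> real" where
  "stirling_remainder n = ln (fact n) - (real n + 1 / 2) * ln (real n) + real n"

text \<open>
  The difference of consecutive remainders is, up to sign, the trapezoid error for the integral of the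
  logarithm from \<open>n\<close> to \<open>n + 1\<close>.
\<close>

lemma stirling_remainder_diff_bound:
  assumes "n > 0"
  shows "\<bar>stirling_remainder (Suc n) - stirling_remainder n\<bar> \<le> 1 / real n ^ 2"
proof -
  let ?F = "\<lambda>z::real. z * ln z - z"
  have pos: "z \<ge> real n" if "z \<in> closed_segment (real n) (real (Suc n))" for z
    using that by (simp add: closed_segment_eq_real_ivl)
  have "norm (?F (real (Suc n)) - ?F (real n)
              - (real (Suc n) - real n) * (ln (real n) + ln (real (Suc n))) / 2)
          \<le> 1 / real n ^ 2 * norm (real (Suc n) - real n) ^ 3 / 2"
  proof (rule trapezoid_rule_error_bound[where f' = "\<lambda>z. 1 / z" and f'' = "\<lambda>z. - 1 / z ^ 2"])
    fix z assume z: "z \<in> closed_segment (real n) (real (Suc n))"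
    have z0: "z > 0" using pos[OF z] assms by simp
    show "(?F has_field_derivative ln z) (at z)"
      using z0 by (auto intro!: derivative_eq_intros)
    show "(ln has_field_derivative 1 / z) (at z)"
      using z0 by (auto intro!: derivative_eq_intros)
    show "((\<lambda>z. 1 / z) has_field_derivative - 1 / z ^ 2) (at z)"
      using z0 by (auto intro!: derivative_eq_intros simp: power2_eq_square)
    show "norm (- 1 / z ^ 2) \<le> 1 / real n ^ 2"
      using pos[OF z] assms z0 by (simp add: divide_left_mono)
  qed
  moreover have "ln (fact (Suc n) :: real) = ln (real (Suc n)) + ln (fact n)"
    by (simp add: ln_mult del: of_nat_Suc)
  hence "?F (real (Suc n)) - ?F (real n)
           - (real (Suc n) - real n) * (ln (real n) + ln (real (Suc n))) / 2 =
         stirling_remainder n - stirling_remainder (Suc n)"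
    by (simp add: stirling_remainder_def field_simps del: fact_Suc)
  moreover have "1 / real n ^ 2 * norm (real (Suc n) - real n) ^ 3 / 2 \<le> 1 / real n ^ 2"
    using assms by (simp add: field_simps)
  ultimately show ?thesis by (simp add: abs_minus_commute)
qed

lemma convergent_stirling_remainder: "convergent stirling_remainder"
proof -
  let ?d = "\<lambda>n. stirling_remainder (Suc (Suc n)) - stirling_remainder (Suc n)"
  have "norm (?d n) \<le> 1 / real (Suc n) ^ 2" for n
    using stirling_remainder_diff_bound[of "Suc n"] by simp
  hence "summable ?d"
    by (intro summable_comparison_test[OF _ summable_inverse_squares_Suc]) auto
  hence "(\<lambda>n. \<Sum>k<n. ?d k) \<longlonglongrightarrow> suminf ?d"
    by (rule summable_LIMSEQ)
  moreover have "(\<Sum>k<n. ?d k) = stirling_remainder (Suc n) - stirling_remainder 1" for n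
    by (induction n) auto
  ultimately have "(\<lambda>n. stirling_remainder (Suc n) - stirling_remainder 1 + stirling_remainder 1)
      \<longlonglongrightarrow> suminf ?d + stirling_remainder 1"
    by (intro tendsto_add tendsto_const) simp
  hence "(\<lambda>n. stirling_remainder (Suc n)) \<longlonglongrightarrow> suminf ?d + stirling_remainder 1"
    by simp
  hence "stirling_remainder \<longlonglongrightarrow> suminf ?d + stirling_remainder 1"
    by (subst (asm) filterlim_sequentially_Suc)
  thus ?thesis by (auto simp: convergent_def)
qed

lemma wallis_product_eq_fact:
  "(\<Prod>k=1..n. (4*real k^2) / (4*real k^2 - 1)) =
     2 ^ (4 * n) * fact n ^ 4 / (fact (2 * n) ^ 2 * (2 * real n + 1))"
proof (induction n)
  case (Suc n)
  define u v b where "u = 2 * real n + 1" and "v = 2 * real n + 3" and "b = real n + 1"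
  have nz: "u \<noteq> 0" "v \<noteq> 0" "b \<noteq> 0"
    unfolding u_def v_def b_def by linarith+
  have alg: "p * f ^ 4 / (g ^ 2 * u) * ((2 * b) ^ 2 / (u * v)) =
        16 * p * (b * f) ^ 4 / ((2 * b * u * g) ^ 2 * v)" if "g \<noteq> 0" for p f g :: real
    using nz that by (simp add: divide_simps power_mult_distrib) (simp add: eval_nat_numeral)
  have "(\<Prod>k=1..Suc n. (4*real k^2) / (4*real k^2 - 1)) =
      2 ^ (4 * n) * fact n ^ 4 / (fact (2 * n) ^ 2 * u) *
        (4 * real (Suc n) ^ 2 / (4 * real (Suc n) ^ 2 - 1))"
    using Suc by (simp add: u_def)
  also have "4 * real (Suc n) ^ 2 = (2 * b) ^ 2"
    by (simp add: b_def power2_eq_square algebra_simps)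
  also have "(2 * b) ^ 2 - 1 = u * v"
    by (simp add: b_def u_def v_def power2_eq_square algebra_simps)
  also note alg[OF fact_nonzero]
  also have "16 * 2 ^ (4 * n) = (2::real) ^ (4 * Suc n)"
    by (simp add: power_add)
  also have "b * fact n = fact (Suc n)"
    by (simp add: b_def)
  also have "2 * b * u * fact (2 * n) = fact (2 * Suc n)"
    by (simp add: b_def u_def algebra_simps)
  also have "v = 2 * real (Suc n) + 1"
    by (simp add: v_def)
  finally show ?case .
qed simp

text \<open>
  The differences being summable, the remainder \<open>D(n)\<close> has some limit \<open>L\<close>. In \<open>4 D(n) - 2 D(2 n)\<close> all
  growing terms cancel and the logarithm of the Wallis product is left, which determines \<open>2 L\<close>.
\<close>

theorem stirling_remainder_tendsto: "stirling_remainder \<longlonglongrightarrow> ln (2 * pi) / 2"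
proof -
  obtain L where L: "stirling_remainder \<longlonglongrightarrow> L"
    using convergent_stirling_remainder by (auto simp: convergent_def)
  have L2: "(\<lambda>n. stirling_remainder (2 * n)) \<longlonglongrightarrow> L"
    by (rule filterlim_compose[OF L]) (simp add: filterlim_at_top_mult_tendsto_pos mult_nat_left_at_top)
  let ?W = "\<lambda>n. \<Prod>k=1..n. (4*real k^2) / (4*real k^2 - 1)"
  have "(\<lambda>n. ln (?W n) + ln (2 + 1 / real n) + ln 2) \<longlonglongrightarrow> ln (pi / 2) + ln (2 + 0) + ln 2"
    by (intro tendsto_intros wallis lim_const_over_n) auto
  moreover have "\<forall>\<^sub>F n in sequentially. ln (?W n) + ln (2 + 1 / real n) + ln 2 =
      4 * stirling_remainder n - 2 * stirling_remainder (2 * n)"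
    using eventually_gt_at_top[of 0]
  proof eventually_elim
    case (elim n)
    have "2 + 1 / real n = (2 * real n + 1) / real n"
      using elim by (simp add: field_simps)
    hence "ln (2 + 1 / real n) = ln (2 * real n + 1) - ln (real n)"
      using elim by (simp add: ln_div)
    moreover have "ln (?W n) = real (4 * n) * ln 2 + 4 * ln (fact n)
        - (2 * ln (fact (2 * n)) + ln (2 * real n + 1))"
      unfolding wallis_product_eq_fact
      by (simp add: ln_div ln_mult ln_realpow add_pos_nonneg)
    moreover have "ln (real (2 * n)) = ln 2 + ln (real n)"
      using elim by (simp add: ln_mult)
    ultimately show ?case
      by (simp add: stirling_remainder_def algebra_simps)
  qed
  ultimately have "(\<lambda>n. 4 * stirling_remainder n - 2 * stirling_remainder (2 * n))
      \<longlonglongrightarrow> ln (pi / 2) + ln (2 + 0) + ln 2"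
    by (rule Lim_transform_eventually)
  moreover have "(\<lambda>n. 4 * stirling_remainder n - 2 * stirling_remainder (2 * n))
      \<longlonglongrightarrow> 4 * L - 2 * L"
    by (intro tendsto_intros L L2)
  ultimately have "4 * L - 2 * L = ln (pi / 2) + ln 2 + ln 2"
    using LIMSEQ_unique by fastforce
  hence "L = ln (2 * pi) / 2"
    by (simp add: ln_div ln_mult)
  with L show ?thesis by blast
qed

section \<open>Sums of logarithms\<close>

lemma equidistant_point_in_segment:
  fixes y :: complex
  assumes "n \<le> N" "N > 0"
  shows "1 + of_nat n * y / of_nat N \<in> closed_segment 1 (1 + y)"
  unfolding closed_segment_def using assms
  by (intro CollectI exI[of _ "real n / real N"])
     (auto simp: scaleR_conv_of_real algebra_simps add_divide_distrib)

text \<open>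
  The trapezoid rule with \<open>N\<close> steps for the integral of \<open>log\<close> from \<open>1\<close> to \<open>1 + y\<close>: the error
  is \<open>O(1 / N\<^sup>2)\<close> for the integral and so \<open>O(1 / N)\<close> after multiplication by \<open>N / y\<close>. The constant
  \<open>- log (1 + y) / 2\<close> accounts for the end point \<open>n = N\<close>, which the sum omits and which has
  half weight in the rule; the other end point contributes \<open>log 1 = 0\<close>.
\<close>

lemma sum_Ln_segment_asymptotics:
  fixes y :: complex
  assumes slit: "closed_segment 1 (1 + y) \<inter> \<real>\<^sub>\<le>\<^sub>0 = {}"
  obtains I where
    "(\<lambda>N. (\<Sum>n=1..<N. Ln (1 + of_nat n * y / of_nat N)) - of_nat N * I) \<longlonglongrightarrow> - Ln (1 + y) / 2"
proof -
  let ?S = "closed_segment 1 (1 + y)"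
  have "continuous_on ?S (\<lambda>z. norm (- 1 / z ^ 2))"
    using slit by (intro continuous_intros) auto
  then obtain M where M: "\<And>z. z \<in> ?S \<Longrightarrow> norm (- 1 / z ^ 2) \<le> M"
    using continuous_attains_sup[of ?S "\<lambda>z. norm (- 1 / z ^ 2)"] by auto
  define F where "F = (\<lambda>z::complex. z * Ln z - z)"
  \<comment> \<open>The mean value of \<open>log\<close> on the segment. For \<open>y = 0\<close> the quotient is \<open>0\<close>, which is the mean value \<open>log 1\<close>.\<close>
  define I where "I = (F (1 + y) - F 1) / y"
  define p where "p = (\<lambda>N n. 1 + of_nat n * y / of_nat N)"
  have p_in: "p N n \<in> ?S" if "n \<le> N" "N > 0" for N n :: nat
    unfolding p_def using that by (rule equidistant_point_in_segment)
  have err: "norm (F (p N (Suc n)) - F (p N n) - (y / of_nat N) * ((Ln (p N n) + Ln (p N (Suc n))) / 2))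
               \<le> M * (norm y / real N) ^ 3 / 2" if "n < N" for n N
  proof -
    have step: "p N (Suc n) - p N n = y / of_nat N"
      by (simp add: p_def add_divide_distrib algebra_simps)
    have sub: "closed_segment (p N n) (p N (Suc n)) \<subseteq> ?S"
      using p_in[of n N] p_in[of "Suc n" N] that by (intro closed_segment_subset) auto
    have "norm (F (p N (Suc n)) - F (p N n)
            - (p N (Suc n) - p N n) * (Ln (p N n) + Ln (p N (Suc n))) / 2)
          \<le> M * norm (p N (Suc n) - p N n) ^ 3 / 2"
    proof (rule trapezoid_rule_error_bound[where f' = "\<lambda>w. 1 / w" and f'' = "\<lambda>w. - 1 / w ^ 2"])
      fix z assume "z \<in> closed_segment (p N n) (p N (Suc n))"
      hence z: "z \<in> ?S" "z \<notin> \<real>\<^sub>\<le>\<^sub>0" using sub slit by auto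
      hence z0: "z \<noteq> 0" by auto
      show "(F has_field_derivative Ln z) (at z)"
        unfolding F_def using z z0 by (auto intro!: derivative_eq_intros)
      show "(Ln has_field_derivative 1 / z) (at z)"
        using has_field_derivative_Ln[OF z(2)] by (simp add: inverse_eq_divide)
      show "((\<lambda>w. 1 / w) has_field_derivative - 1 / z ^ 2) (at z)"
        using z0 by (auto intro!: derivative_eq_intros simp: power2_eq_square)
      show "norm (- 1 / z ^ 2) \<le> M"
        by (rule M[OF z(1)])
    qed
    thus ?thesis
      by (simp add: step norm_divide)
  qed
  have main: "norm (of_nat N * I - discrete_trapezoid (\<lambda>n. Ln (p N n)) N) \<le> M * norm y ^ 2 / 2 / real N"
    if N: "N > 0" for N
  proof (cases "y = 0")
    case True
    thus ?thesis by (simp add: I_def p_def discrete_trapezoid_def)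
  next
    case False
    have "(y / of_nat N) * (of_nat N * I) = F (1 + y) - F 1"
      using N False by (simp add: I_def)
    also have "\<dots> = (\<Sum>n<N. F (p N (Suc n)) - F (p N n))"
      using N by (subst sum_lessThan_telescope) (simp add: p_def)
    finally have "(y / of_nat N) * (of_nat N * I - discrete_trapezoid (\<lambda>n. Ln (p N n)) N) =
        (\<Sum>n<N. F (p N (Suc n)) - F (p N n) - (y / of_nat N) * ((Ln (p N n) + Ln (p N (Suc n))) / 2))"
      by (simp only: discrete_trapezoid_def sum_subtractf right_diff_distrib sum_distrib_left)
    also have "norm \<dots> \<le> (\<Sum>n<N. M * (norm y / real N) ^ 3 / 2)"
      using err by (intro sum_norm_le) auto
    also have "\<dots> = (norm y / real N) * (M * norm y ^ 2 / 2 / real N)"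
      using N by (simp add: eval_nat_numeral field_simps)
    finally have "(norm y / real N) * norm (of_nat N * I - discrete_trapezoid (\<lambda>n. Ln (p N n)) N) \<le> \<dots>"
      by (simp add: norm_mult norm_divide)
    thus ?thesis
      using N False by (subst (asm) mult_le_cancel_left_pos) auto
  qed
  have "(\<lambda>N. of_nat N * I - discrete_trapezoid (\<lambda>n. Ln (p N n)) N) \<longlonglongrightarrow> 0"
  proof (rule Lim_null_comparison)
    show "(\<lambda>N. M * norm y ^ 2 / 2 / real N) \<longlonglongrightarrow> 0"
      by (rule lim_const_over_n)
    show "\<forall>\<^sub>F N in sequentially. norm (of_nat N * I - discrete_trapezoid (\<lambda>n. Ln (p N n)) N)
            \<le> M * norm y ^ 2 / 2 / real N"
      using main by (rule eventually_mono[OF eventually_gt_at_top[of 0]])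
  qed
  from tendsto_diff[OF tendsto_const[of "- Ln (1 + y) / 2"] this]
  have lim: "(\<lambda>N. - Ln (1 + y) / 2 - (of_nat N * I - discrete_trapezoid (\<lambda>n. Ln (p N n)) N))
      \<longlonglongrightarrow> - Ln (1 + y) / 2"
    by simp
  show thesis
  proof (rule that, rule Lim_transform_eventually[OF lim])
    show "\<forall>\<^sub>F N in sequentially.
        - Ln (1 + y) / 2 - (of_nat N * I - discrete_trapezoid (\<lambda>n. Ln (p N n)) N) =
        (\<Sum>n=1..<N. Ln (1 + of_nat n * y / of_nat N)) - of_nat N * I"
      using eventually_gt_at_top[of 0]
      by eventually_elim (simp add: discrete_trapezoid_eq_interior p_def)
  qed
qed

text \<open>
  This collects everything that a truncated sum contains besides trapezoid errors: the integrals along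
  the rows and the half-weighted boundary ray. The instances \<open>y = x - 1\<close> and \<open>y = x\<close> belong to the
  triangle, where row \<open>n\<close> ends at \<open>n x + (N - n)\<close>, and to the square, where it ends at \<open>n x + N\<close>. The
  \<open>log N\<close> in Stirling's formula cancels against that of the harmonic number.
\<close>

lemma sum_Ln_ratio_asymptotics:
  fixes x y :: complex
  assumes slit: "closed_segment 1 (1 + y) \<inter> \<real>\<^sub>\<le>\<^sub>0 = {}" and x: "x \<notin> \<real>\<^sub>\<le>\<^sub>0"
  obtains A where
    "(\<lambda>N. (\<Sum>n=1..<N. Ln (of_nat N + of_nat n * y) - Ln (of_nat n * x))
           + (\<Sum>k=1..<N. 1 / of_nat k) / 2 - of_nat N * A)
       \<longlonglongrightarrow> euler_mascheroni / 2 - of_real (ln (2 * pi)) / 2 + Ln x - Ln (1 + y) / 2"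
proof -
  obtain I where I:
    "(\<lambda>N. (\<Sum>n=1..<N. Ln (1 + of_nat n * y / of_nat N)) - of_nat N * I) \<longlonglongrightarrow> - Ln (1 + y) / 2"
    using sum_Ln_segment_asymptotics[OF slit] by blast
  define A where "A = I + 1 - Ln x"
  have st: "(\<lambda>N. complex_of_real (stirling_remainder N)) \<longlonglongrightarrow> of_real (ln (2 * pi) / 2)"
    by (intro tendsto_of_real stirling_remainder_tendsto)
  have hm: "(\<lambda>N. complex_of_real (harm N - ln (real N))) \<longlonglongrightarrow> euler_mascheroni"
    by (rule euler_mascheroni_LIMSEQ_of_real)
  have inv: "(\<lambda>N. 1 / of_nat N / 2 :: complex) \<longlonglongrightarrow> 0 / 2"
    by (intro tendsto_divide lim_1_over_n tendsto_const) auto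
  note lims = tendsto_diff[OF tendsto_add[OF tendsto_add[OF tendsto_diff[OF I st]
          tendsto_const[of "Ln x"]] tendsto_divide[OF hm tendsto_const[of 2]]] inv]
  show thesis
  proof (rule that[of A])
    have "(\<lambda>N. ((\<Sum>n=1..<N. Ln (1 + of_nat n * y / of_nat N)) - of_nat N * I)
           - of_real (stirling_remainder N) + Ln x + of_real (harm N - ln (real N)) / 2
           - 1 / of_nat N / 2)
       \<longlonglongrightarrow> euler_mascheroni / 2 - of_real (ln (2 * pi)) / 2 + Ln x - Ln (1 + y) / 2"
      using lims by (simp add: algebra_simps)
    thus "(\<lambda>N. (\<Sum>n=1..<N. Ln (of_nat N + of_nat n * y) - Ln (of_nat n * x))
           + (\<Sum>k=1..<N. 1 / of_nat k) / 2 - of_nat N * A)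
       \<longlonglongrightarrow> euler_mascheroni / 2 - of_real (ln (2 * pi)) / 2 + Ln x - Ln (1 + y) / 2"
    proof (rule Lim_transform_eventually)
      show "\<forall>\<^sub>F N in sequentially. ((\<Sum>n=1..<N. Ln (1 + of_nat n * y / of_nat N)) - of_nat N * I)
           - of_real (stirling_remainder N) + Ln x + of_real (harm N - ln (real N)) / 2
           - 1 / of_nat N / 2 =
           (\<Sum>n=1..<N. Ln (of_nat N + of_nat n * y) - Ln (of_nat n * x))
           + (\<Sum>k=1..<N. 1 / of_nat k) / 2 - of_nat N * A"
        using eventually_gt_at_top[of 0]
      proof eventually_elim
        case (elim N)
        have x0: "x \<noteq> 0" using x by auto
        have term_eq: "Ln (of_nat N + of_nat n * y) - Ln (of_nat n * x) =
            Ln (1 + of_nat n * y / of_nat N) + of_real (ln (real N)) - of_real (ln (real n)) - Ln x"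
          if n: "n \<in> {1..<N}" for n
        proof -
          have "1 + of_nat n * y / of_nat N \<in> closed_segment 1 (1 + y)"
            using n elim by (intro equidistant_point_in_segment) auto
          hence "1 + of_nat n * y / of_nat N \<noteq> 0" using slit by auto
          hence "Ln (of_nat N * (1 + of_nat n * y / of_nat N)) =
              of_real (ln (real N)) + Ln (1 + of_nat n * y / of_nat N)"
            using elim by (simp add: Ln_times_of_nat)
          moreover have "of_nat N * (1 + of_nat n * y / of_nat N) = of_nat N + of_nat n * y"
            using elim by (simp add: field_simps)
          moreover have "Ln (of_nat n * x) = of_real (ln (real n)) + Ln x"
            using n x0 by (simp add: Ln_times_of_nat)
          ultimately show ?thesis by simp
        qed
        have ln_fact: "(\<Sum>n=1..<N. ln (real n)) = ln (fact N) - ln (real N)"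
          using elim
          by (induction N rule: nat_induct_non_zero) (simp_all add: ln_mult del: of_nat_Suc)
        have "(\<Sum>n=1..<N. Ln (of_nat N + of_nat n * y) - Ln (of_nat n * x)) =
            (\<Sum>n=1..<N. Ln (1 + of_nat n * y / of_nat N)) + of_nat (N - 1) * of_real (ln (real N))
             - of_real (\<Sum>n=1..<N. ln (real n)) - of_nat (N - 1) * Ln x"
          by (subst sum.cong[OF refl term_eq])
             (simp_all add: sum.distrib sum_subtractf of_real_sum)
        also have "of_nat (N - 1) = (of_nat N - 1 :: complex)"
          using elim by (simp add: of_nat_diff)
        also note ln_fact
        finally have logs: "(\<Sum>n=1..<N. Ln (of_nat N + of_nat n * y) - Ln (of_nat n * x)) =
            (\<Sum>n=1..<N. Ln (1 + of_nat n * y / of_nat N)) + (of_nat N - 1) * of_real (ln (real N))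
             - of_real (ln (fact N) - ln (real N)) - (of_nat N - 1) * Ln x" .
        have harm: "(\<Sum>k=1..<N. 1 / of_nat k) = complex_of_real (harm N) - 1 / of_nat N"
        proof -
          obtain m where m: "N = Suc m" using elim by (cases N) auto
          show ?thesis
            unfolding m of_real_harm harm_Suc
            by (simp add: harm_def inverse_eq_divide atLeastLessThanSuc_atLeastAtMost del: of_nat_Suc sum.op_ivl_Suc)
        qed
        show ?case
          unfolding logs harm stirling_remainder_def A_def
          by (simp add: field_simps)
      qed
    qed
  qed
qed

section \<open>Asymptotics of the truncated sums\<close>

lemma closed_segment_1_avoids_nonpos_Reals:
  fixes z :: complex
  assumes "z \<notin> \<real>\<^sub>\<le>\<^sub>0"
  shows "closed_segment 1 z \<inter> \<real>\<^sub>\<le>\<^sub>0 = {}"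
proof -
  have "(1 - t) *\<^sub>R 1 + t *\<^sub>R z \<notin> \<real>\<^sub>\<le>\<^sub>0" if "0 \<le> t" "t \<le> 1" for t :: real
    using cone_avoids_nonpos_Reals[OF assms, of t "1 - t"] that
    by (simp add: scaleR_conv_of_real add.commute)
  thus ?thesis by (auto simp: closed_segment_def)
qed

lemma ramanujan_period_function_eq:
  assumes "x \<notin> \<real>\<^sub>\<le>\<^sub>0"
  shows "ramanujan_period_function x =
           ramanujan_digamma_series x - euler_mascheroni / 2 + of_real (ln (2 * pi)) / 2 - Ln x / 2"
proof -
  have "Ln (of_real (2 * pi) * inverse x) = of_real (ln (2 * pi)) - Ln x"
    using assms Ln_of_real[of "2 * pi"] by (subst Ln_times_of_real) (auto simp: Ln_inverse)
  moreover have "2 * of_real pi / x = of_real (2 * pi) * inverse x"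
    by (simp add: divide_inverse)
  ultimately have "Ln (2 * of_real pi / x) = of_real (ln (2 * pi)) - Ln x"
    by (simp only:)
  thus ?thesis
    unfolding ramanujan_period_function_def by (simp only:) (simp add: field_simps)
qed

abbreviation lattice_recip :: "complex \<Rightarrow> nat \<Rightarrow> nat \<Rightarrow> complex" where
  "lattice_recip x n k \<equiv> 1 / (of_nat n * x + of_nat k)"

lemma discrete_trapezoid_lattice_recip:
  "discrete_trapezoid (lattice_recip x n) m =
     Ln (of_nat n * x + of_nat m) - Ln (of_nat n * x)
       - (\<Sum>k<m. log_trapezoid_error (of_nat n * x + of_nat k))"
  by (simp add: sum_log_trapezoid_error)

text \<open>
  For \<open>y = x - 1\<close> the logarithm at the end of the hypotenuse is \<open>log x\<close>, so the logarithms contribute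
  \<open>log x - log x / 2\<close> to the constant term, just as the period function requires.
\<close>

lemma triangle_sum_asymptotics:
  assumes x: "x \<notin> \<real>\<^sub>\<le>\<^sub>0"
  obtains B where
    "(\<lambda>N. triangle_sum (lattice_recip x) N - of_nat N * B) \<longlonglongrightarrow> - ramanujan_period_function x"
proof -
  obtain B where B:
    "(\<lambda>N. (\<Sum>n=1..<N. Ln (of_nat N + of_nat n * (x - 1)) - Ln (of_nat n * x))
           + (\<Sum>k=1..<N. 1 / of_nat k) / 2 - of_nat N * B)
       \<longlonglongrightarrow> euler_mascheroni / 2 - of_real (ln (2 * pi)) / 2 + Ln x - Ln (1 + (x - 1)) / 2"
    using sum_Ln_ratio_asymptotics[of "x - 1" x] closed_segment_1_avoids_nonpos_Reals[OF x] x
    by auto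
  have rows: "(\<lambda>N. \<Sum>n=1..<N. \<Sum>k<N - n. log_trapezoid_error (of_nat n * x + of_nat k))
      \<longlonglongrightarrow> ramanujan_digamma_series x"
    by (rule ramanujan_digamma_series_eq_double_sum[OF x]) auto
  have eq: "triangle_sum (lattice_recip x) N =
      (\<Sum>n=1..<N. Ln (of_nat N + of_nat n * (x - 1)) - Ln (of_nat n * x))
      + (\<Sum>k=1..<N. 1 / of_nat k) / 2
      - (\<Sum>n=1..<N. \<Sum>k<N - n. log_trapezoid_error (of_nat n * x + of_nat k))" for N
  proof -
    have "of_nat n * x + of_nat (N - n) = of_nat N + of_nat n * (x - 1)" if "n \<in> {1..<N}" for n
      using that by (simp add: of_nat_diff algebra_simps)
    hence "(\<Sum>n=1..<N. discrete_trapezoid (lattice_recip x n) (N - n)) =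
        (\<Sum>n=1..<N. Ln (of_nat N + of_nat n * (x - 1)) - Ln (of_nat n * x)
           - (\<Sum>k<N - n. log_trapezoid_error (of_nat n * x + of_nat k)))"
      by (intro sum.cong refl) (simp only: discrete_trapezoid_lattice_recip)
    thus ?thesis
      by (simp add: triangle_sum_def sum_subtractf)
  qed
  show thesis
  proof (rule that[of B])
    show "(\<lambda>N. triangle_sum (lattice_recip x) N - of_nat N * B) \<longlonglongrightarrow> - ramanujan_period_function x"
      unfolding eq ramanujan_period_function_eq[OF x]
      using tendsto_diff[OF B rows] by (simp add: algebra_simps)
  qed
qed

text \<open>
  A Riemann sum for the integral of \<open>1 / (x + t)\<close> over \<open>0 \<le> t \<le> 1\<close>. The trapezoid errors of this row are
  negligible since all its points have size of order \<open>N\<close>.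
\<close>

lemma last_row_asymptotics:
  assumes x: "x \<notin> \<real>\<^sub>\<le>\<^sub>0"
  shows "(\<lambda>N. \<Sum>k=1..<N. lattice_recip x N k) \<longlonglongrightarrow> Ln (1 + x) - Ln x"
proof -
  have x0: "x \<noteq> 0" and x1: "1 + x \<noteq> 0"
    using x lattice_point_avoids_nonpos_Reals[OF x, of 1 1] by (auto simp: add.commute)
  obtain C where C: "C \<ge> 0" "\<And>n k. n > 0 \<Longrightarrow>
      norm (log_trapezoid_error (of_nat n * x + of_nat k)) \<le> C / real (n + k) ^ 3"
    using log_trapezoid_error_bound[OF x] by blast
  have "(\<lambda>N. \<Sum>k<N. log_trapezoid_error (of_nat N * x + of_nat k)) \<longlonglongrightarrow> 0"
  proof (rule Lim_null_comparison)
    show "(\<lambda>N. 2 * C / real N ^ 2) \<longlonglongrightarrow> 0"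
      by real_asymp
    show "\<forall>\<^sub>F N in sequentially.
        norm (\<Sum>k<N. log_trapezoid_error (of_nat N * x + of_nat k)) \<le> 2 * C / real N ^ 2"
      using eventually_gt_at_top[of 0]
    proof eventually_elim
      case (elim N)
      show ?case
        using sum_log_trapezoid_error_tail[where C = C and x = x and m = 0 and K = N, OF C(2) C(1) elim]
        by simp
    qed
  qed
  moreover have "(\<lambda>N. 1 / of_nat N * ((1 / x + 1 / (1 + x)) / 2)) \<longlonglongrightarrow> 0 * ((1 / x + 1 / (1 + x)) / 2)"
    by (intro tendsto_mult lim_1_over_n tendsto_const)
  ultimately have "(\<lambda>N. (Ln (1 + x) - Ln x) - (\<Sum>k<N. log_trapezoid_error (of_nat N * x + of_nat k))
        - 1 / of_nat N * ((1 / x + 1 / (1 + x)) / 2))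
      \<longlonglongrightarrow> (Ln (1 + x) - Ln x) - 0 - 0 * ((1 / x + 1 / (1 + x)) / 2)"
    by (intro tendsto_diff tendsto_const)
  hence "(\<lambda>N. (Ln (1 + x) - Ln x) - (\<Sum>k<N. log_trapezoid_error (of_nat N * x + of_nat k))
        - 1 / of_nat N * ((1 / x + 1 / (1 + x)) / 2)) \<longlonglongrightarrow> Ln (1 + x) - Ln x"
    by simp
  thus ?thesis
  proof (rule Lim_transform_eventually)
    show "\<forall>\<^sub>F N in sequentially.
        (Ln (1 + x) - Ln x) - (\<Sum>k<N. log_trapezoid_error (of_nat N * x + of_nat k))
        - 1 / of_nat N * ((1 / x + 1 / (1 + x)) / 2) = (\<Sum>k=1..<N. lattice_recip x N k)"
      using eventually_gt_at_top[of 0]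
    proof eventually_elim
      case (elim N)
      have end_eq: "of_nat N * x + of_nat N = of_nat N * (1 + x)"
        by (simp add: algebra_simps)
      have logs: "Ln (of_nat N * x + of_nat N) - Ln (of_nat N * x) = Ln (1 + x) - Ln x"
        unfolding end_eq using elim x0 x1 by (simp add: Ln_times_of_nat)
      have ends: "(lattice_recip x N 0 + lattice_recip x N N) / 2 =
          1 / of_nat N * ((1 / x + 1 / (1 + x)) / 2)"
      proof -
        have "1 / (m * a) + 1 / (m * b) = 1 / m * (1 / a + 1 / b)" for m a b :: complex
          by (simp add: distrib_left)
        thus ?thesis
          by (simp only: end_eq of_nat_0 add_0_right times_divide_eq_right)
      qed
      have "(Ln (1 + x) - Ln x) - (\<Sum>k<N. log_trapezoid_error (of_nat N * x + of_nat k)) =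
          discrete_trapezoid (lattice_recip x N) N"
        by (simp only: discrete_trapezoid_lattice_recip logs)
      also have "\<dots> = 1 / of_nat N * ((1 / x + 1 / (1 + x)) / 2) + (\<Sum>k=1..<N. lattice_recip x N k)"
        by (simp only: discrete_trapezoid_eq_interior[OF elim] ends)
      finally show ?case
        by (simp only: add_diff_cancel_left')
    qed
  qed
qed

text \<open>
  Compared with the triangle, the integrals along the rows give \<open>- log (1 + x) / 2\<close> in place of
  \<open>- log x / 2\<close>. The additional edge \<open>n = N\<close> makes up for exactly this difference.
\<close>

lemma square_sum_asymptotics:
  assumes x: "x \<notin> \<real>\<^sub>\<le>\<^sub>0"
  obtains A where
    "(\<lambda>N. square_sum (lattice_recip x) N - of_nat N * A) \<longlonglongrightarrow> - ramanujan_period_function x"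
proof -
  have x1: "1 + x \<notin> \<real>\<^sub>\<le>\<^sub>0"
    using lattice_point_avoids_nonpos_Reals[OF x, of 1 1] by (simp add: add.commute)
  obtain A where A:
    "(\<lambda>N. (\<Sum>n=1..<N. Ln (of_nat N + of_nat n * x) - Ln (of_nat n * x))
           + (\<Sum>k=1..<N. 1 / of_nat k) / 2 - of_nat N * A)
       \<longlonglongrightarrow> euler_mascheroni / 2 - of_real (ln (2 * pi)) / 2 + Ln x - Ln (1 + x) / 2"
    using sum_Ln_ratio_asymptotics[OF closed_segment_1_avoids_nonpos_Reals[OF x1] x] by blast
  have rows: "(\<lambda>N. \<Sum>n=1..<N. \<Sum>k<N. log_trapezoid_error (of_nat n * x + of_nat k))
      \<longlonglongrightarrow> ramanujan_digamma_series x"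
    by (rule ramanujan_digamma_series_eq_double_sum[OF x]) auto
  have eq: "square_sum (lattice_recip x) N =
      (\<Sum>n=1..<N. Ln (of_nat N + of_nat n * x) - Ln (of_nat n * x))
      + (\<Sum>k=1..<N. 1 / of_nat k) / 2 + (\<Sum>k=1..<N. lattice_recip x N k) / 2
      - (\<Sum>n=1..<N. \<Sum>k<N. log_trapezoid_error (of_nat n * x + of_nat k))" for N
  proof -
    have "(\<Sum>n=1..<N. discrete_trapezoid (lattice_recip x n) N) =
        (\<Sum>n=1..<N. Ln (of_nat N + of_nat n * x) - Ln (of_nat n * x)
           - (\<Sum>k<N. log_trapezoid_error (of_nat n * x + of_nat k)))"
      by (intro sum.cong refl)
         (simp only: discrete_trapezoid_lattice_recip add.commute[of "of_nat N"])
    thus ?thesis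
      by (simp add: square_sum_def sum_subtractf sum.distrib add_divide_distrib)
  qed
  show thesis
  proof (rule that[of A])
    show "(\<lambda>N. square_sum (lattice_recip x) N - of_nat N * A) \<longlonglongrightarrow> - ramanujan_period_function x"
      unfolding eq ramanujan_period_function_eq[OF x]
      using tendsto_diff[OF tendsto_add[OF A tendsto_divide[OF last_row_asymptotics[OF x]
              tendsto_const[of 2]]] rows]
      by (simp add: algebra_simps diff_divide_distrib)
  qed
qed

section \<open>The symmetric and the three-term relation\<close>

text \<open>
  A multiple of \<open>N\<close> that converges is zero. Hence the coefficients of \<open>N\<close> agree, and with them the
  constant terms.
\<close>

lemma constant_term_unique:
  fixes u v :: "nat \<Rightarrow> complex"
  assumes u: "(\<lambda>N. u N - of_nat N * a) \<longlonglongrightarrow> p" and v: "(\<lambda>N. v N - of_nat N * b) \<longlonglongrightarrow> q"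
    and eq: "\<And>N. N > 0 \<Longrightarrow> u N = v N"
  shows "p = q"
proof -
  have "(\<lambda>N. (u N - of_nat N * a) - (v N - of_nat N * b)) \<longlonglongrightarrow> p - q"
    by (intro tendsto_diff u v)
  moreover have "\<forall>\<^sub>F N in sequentially.
      (u N - of_nat N * a) - (v N - of_nat N * b) = of_nat N * (b - a)"
    using eventually_gt_at_top[of 0] by eventually_elim (simp add: eq algebra_simps)
  ultimately have lin: "(\<lambda>N. of_nat N * (b - a)) \<longlonglongrightarrow> p - q"
    by (rule Lim_transform_eventually)
  have "(\<lambda>N. 1 / of_nat N * (of_nat N * (b - a))) \<longlonglongrightarrow> 0 * (p - q)"
    by (intro tendsto_mult lim_1_over_n lin)
  moreover have "\<forall>\<^sub>F N in sequentially. 1 / of_nat N * (of_nat N * (b - a)) = b - a"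
    using eventually_gt_at_top[of 0] by eventually_elim simp
  ultimately have "(\<lambda>N::nat. b - a) \<longlonglongrightarrow> 0 * (p - q)"
    by (rule Lim_transform_eventually)
  hence "b - a = 0"
    by (simp add: LIMSEQ_const_iff)
  thus ?thesis
    using lin by (simp add: LIMSEQ_const_iff)
qed

lemma triangle_sum_mult: "triangle_sum (\<lambda>n k. c * f n k) N = c * triangle_sum f N"
  by (simp add: triangle_sum_def discrete_trapezoid_def sum_distrib_left algebra_simps)

lemma scaled_triangle_sum_asymptotics:
  assumes "x \<notin> \<real>\<^sub>\<le>\<^sub>0"
  obtains B where
    "(\<lambda>N. triangle_sum (\<lambda>n k. c * lattice_recip x n k) N - of_nat N * B)
       \<longlonglongrightarrow> - (c * ramanujan_period_function x)"
proof -
  obtain B where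
    "(\<lambda>N. triangle_sum (lattice_recip x) N - of_nat N * B) \<longlonglongrightarrow> - ramanujan_period_function x"
    using triangle_sum_asymptotics[OF assms] by blast
  from tendsto_mult_left[OF this, of c] show ?thesis
    by (intro that[of "c * B"], unfold triangle_sum_mult) (simp add: algebra_simps)
qed

lemma ramanujan_period_function_symmetric:
  assumes x: "x \<notin> \<real>\<^sub>\<le>\<^sub>0"
  shows "ramanujan_period_function x = 1 / x * ramanujan_period_function (1 / x)"
proof -
  have x0: "x \<noteq> 0" using x by auto
  have inv: "1 / x \<notin> \<real>\<^sub>\<le>\<^sub>0"
    using x by (simp add: divide_inverse)
  obtain A where A:
    "(\<lambda>N. triangle_sum (lattice_recip x) N - of_nat N * A) \<longlonglongrightarrow> - ramanujan_period_function x"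
    using triangle_sum_asymptotics[OF x] by blast
  obtain B where B:
    "(\<lambda>N. triangle_sum (\<lambda>n k. 1 / x * lattice_recip (1 / x) n k) N - of_nat N * B)
       \<longlonglongrightarrow> - (1 / x * ramanujan_period_function (1 / x))"
    using scaled_triangle_sum_asymptotics[OF inv] by blast
  have "lattice_recip x k n = 1 / x * lattice_recip (1 / x) n k" for n k
  proof -
    have "of_nat k * x + of_nat n = x * (of_nat n * (1 / x) + of_nat k)"
      using x0 by (simp add: field_simps)
    thus ?thesis by simp
  qed
  hence "triangle_sum (lattice_recip x) N =
      triangle_sum (\<lambda>n k. 1 / x * lattice_recip (1 / x) n k) N" for N
    by (subst triangle_sum_swap) simp
  from constant_term_unique[OF A B this] show ?thesis by simp
qed

lemma ramanujan_period_function_three_term: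
  assumes x: "x \<notin> \<real>\<^sub>\<le>\<^sub>0"
  shows "ramanujan_period_function x = ramanujan_period_function (x + 1) +
           1 / (x + 1) * ramanujan_period_function (x / (x + 1))"
proof -
  have x1: "x + 1 \<notin> \<real>\<^sub>\<le>\<^sub>0"
    using lattice_point_avoids_nonpos_Reals[OF x, of 1 1] by simp
  hence x10: "x + 1 \<noteq> 0" by auto
  have x0: "x \<noteq> 0" using x by auto
  have "inverse x + 1 \<notin> \<real>\<^sub>\<le>\<^sub>0"
    using lattice_point_avoids_nonpos_Reals[of "inverse x" 1 1] x by simp
  hence "inverse (inverse x + 1) \<notin> \<real>\<^sub>\<le>\<^sub>0"
    by simp
  also have "inverse (inverse x + 1) = x / (x + 1)"
    using x0 x10 by (simp add: field_simps)
  finally have xq: "x / (x + 1) \<notin> \<real>\<^sub>\<le>\<^sub>0" .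
  obtain A where A:
    "(\<lambda>N. square_sum (lattice_recip x) N - of_nat N * A) \<longlonglongrightarrow> - ramanujan_period_function x"
    using square_sum_asymptotics[OF x] by blast
  obtain B where B: "(\<lambda>N. triangle_sum (lattice_recip (x + 1)) N - of_nat N * B)
      \<longlonglongrightarrow> - ramanujan_period_function (x + 1)"
    using triangle_sum_asymptotics[OF x1] by blast
  obtain C where C:
    "(\<lambda>N. triangle_sum (\<lambda>n k. 1 / (x + 1) * lattice_recip (x / (x + 1)) n k) N - of_nat N * C)
       \<longlonglongrightarrow> - (1 / (x + 1) * ramanujan_period_function (x / (x + 1)))"
    using scaled_triangle_sum_asymptotics[OF xq] by blast
  have BC: "(\<lambda>N. (triangle_sum (lattice_recip (x + 1)) N +
          triangle_sum (\<lambda>n k. 1 / (x + 1) * lattice_recip (x / (x + 1)) n k) N) - of_nat N * (B + C))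
      \<longlonglongrightarrow> - (ramanujan_period_function (x + 1) +
             1 / (x + 1) * ramanujan_period_function (x / (x + 1)))"
    using tendsto_add[OF B C] by (simp add: algebra_simps)
  have upper: "lattice_recip x n (n + k) = lattice_recip (x + 1) n k" for n k
    by (simp add: algebra_simps)
  have lower: "lattice_recip x (n + k) k = 1 / (x + 1) * lattice_recip (x / (x + 1)) n k" for n k
  proof -
    have "of_nat (n + k) * x + of_nat k = (x + 1) * (of_nat n * (x / (x + 1)) + of_nat k)"
      using x10 by (simp add: field_simps)
    thus ?thesis by simp
  qed
  have "square_sum (lattice_recip x) N = triangle_sum (lattice_recip (x + 1)) N +
          triangle_sum (\<lambda>n k. 1 / (x + 1) * lattice_recip (x / (x + 1)) n k) N" if "N > 0" for N
    using square_sum_eq_triangle_sums[OF that, of "lattice_recip x"] by (simp only: upper lower)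
  from constant_term_unique[OF A BC this] show ?thesis
    by (simp only: neg_equal_iff_equal)
qed

theorem theorem2p1:
  fixes x :: complex
  assumes "x \<notin> \<real>\<^sub>\<le>\<^sub>0"
  shows "ramanujan_period_function x - ramanujan_period_function (x + 1)
           - 1 / (x + 1) * ramanujan_period_function (x / (x + 1)) = 0
       \<and> ramanujan_period_function x - 1 / x * ramanujan_period_function (1 / x) = 0"
  using ramanujan_period_function_three_term[OF assms] ramanujan_period_function_symmetric[OF assms]
  by simp

end
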